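(* Let $\mathcal{X}^B$ be an irreducible, time-homogeneous, continuous-time Markov chain on $\{1,2,\dots,s\}$ ($s\ge 2$) with transition rate matrix $Q^B$. Then the probabilities $p^B_{\varepsilon B\varepsilon'}$ ($\varepsilon,\varepsilon'\in\{1,2\}$) can be computed from the unique solutions of the following linear equations: the vectors $(p^B_{1B1},p^B_{2B1},\dots,p^B_{sB1})^{\mathrm T}$ and $(p^B_{1B2},p^B_{2B2},\dots,p^B_{sB2})^{\mathrm T}$ are the unique solutions, respectively, of $$Q^B_0\begin{pmatrix} p^B_{1B1} \\ {p^B_{2B1}} \\ {p^B_{3B1}} \\ \vdots \\ {p^B_{sB1}} \end{pmatrix}=\begin{pmatrix} 0 \\ -Q^B_{21} \\ -Q^B_{31} \\ \vdots \\ -Q^B_{s1} \end{pmatrix},\qquad Q^B_0\begin{pmatrix} p^B_{1B2} \\ {p^B_{2B2}} \\ {p^B_{3B2}} \\ \vdots \\ {p^B_{sB2}} \end{pmatrix}=\begin{pmatrix} -Q^B_{12} \\ 0 \\ -Q^B_{32} \\ \vdots \\ -Q^B_{s2} \end{pmatrix}.$$ Moreover, it suffices to solve only one of the two linear equations, since $p^B_{\varepsilon B1}+p^B_{\varepsilon B2}=1$ for $\varepsilon\in\{1,2\}$.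
   Context: For $i\ne j$, $Q^B_{ij}\ge 0$ is the transition rate of $\mathcal{X}^B$ from $i$ to $j$, and $Q^B_{ii}=-\sum_{j\ne i}Q^B_{ij}$. Define the $s\times s$ matrix $$Q^B_0=\begin{bmatrix} Q^B_{11}&0&Q^B_{13}&\dots&Q^B_{1s} \\ 0&Q^B_{22}&Q^B_{23}&\dots&Q^B_{2s} \\ 0&0&Q^B_{33}&\dots&Q^B_{3s} \\ \vdots&\vdots&\vdots&\ddots&\vdots \\ 0&0&Q^B_{s3}&\dots&Q^B_{ss} \end{bmatrix},$$ i.e. $Q^B$ with its first two columns replaced by $Q^B_{11}\mathbf e_1$ and $Q^B_{22}\mathbf e_2$. For $\varepsilon\in\{1,2\}$, $$\sigma^B_\varepsilon=\begin{cases}\inf\{t>0\,|\,\exists u\in(0,t):\ \mathcal{X}^B_u\ne\varepsilon,\ \mathcal{X}^B_t=\varepsilon\},&\text{if }\mathcal{X}^B_0=\varepsilon, \\ \inf\{t>0\,|\,\mathcal{X}^B_t=\varepsilon\},&\text{otherwise,}\end{cases}$$ and for $i\in\{1,2,\dots,s\}$, $\varepsilon'\in\{1,2\}$, $$p^B_{iB\varepsilon'}=\mathrm P(\sigma^B_{\varepsilon'}<\sigma^B_{3-\varepsilon'}\,|\,\mathcal{X}^B_0=i).$$ *)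

theory Defs
  imports "HOL-Probability.Probability" "Jordan_Normal_Form.Matrix"
begin

definition transition_function :: "nat set \<Rightarrow> (real \<Rightarrow> nat \<Rightarrow> nat \<Rightarrow> real) \<Rightarrow> bool" where
  "transition_function S p \<longleftrightarrow>
     (\<forall>t\<ge>0. \<forall>i\<in>S. (\<forall>j\<in>S. 0 \<le> p t i j) \<and> (\<Sum>j\<in>S. p t i j) = 1) \<and>
     (\<forall>i\<in>S. \<forall>j\<in>S. p 0 i j = (if i = j then 1 else 0)) \<and>
     (\<forall>t\<ge>0. \<forall>u\<ge>0. \<forall>i\<in>S. \<forall>k\<in>S. p (t + u) i k = (\<Sum>j\<in>S. p t i j * p u j k))"

definition transition_rates ::
    "nat set \<Rightarrow> (real \<Rightarrow> nat \<Rightarrow> nat \<Rightarrow> real) \<Rightarrow> (nat \<Rightarrow> nat \<Rightarrow> real) \<Rightarrow> bool" where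
  "transition_rates S p Q \<longleftrightarrow>
     (\<forall>i\<in>S. \<forall>j\<in>S. i \<noteq> j \<longrightarrow> 0 \<le> Q i j \<and> ((\<lambda>h. p h i j / h) \<longlongrightarrow> Q i j) (at_right 0)) \<and>
     (\<forall>i\<in>S. Q i i = - (\<Sum>j\<in>S - {i}. Q i j))"

definition irreducible_chain :: "nat set \<Rightarrow> (real \<Rightarrow> nat \<Rightarrow> nat \<Rightarrow> real) \<Rightarrow> bool" where
  "irreducible_chain S p \<longleftrightarrow> (\<forall>i\<in>S. \<forall>j\<in>S. \<exists>t\<ge>0. 0 < p t i j)"

text \<open>
  Time is the half-line of nonnegative reals, so values of \<open>X\<close> at negative times are irrelevant.
  The state space is discrete, so right-continuity of a path means that the path stays constant
  for a positive amount of time after every instant. The initial distribution is arbitrary.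
\<close>

definition ctmc ::
    "nat set \<Rightarrow> (real \<Rightarrow> nat \<Rightarrow> nat \<Rightarrow> real) \<Rightarrow> 'w measure \<Rightarrow> (real \<Rightarrow> 'w \<Rightarrow> nat) \<Rightarrow> bool" where
  "ctmc S p M X \<longleftrightarrow>
     prob_space M \<and>
     (\<forall>t\<ge>0. X t \<in> measurable M (count_space S)) \<and>
     (\<forall>w\<in>space M. \<forall>t\<ge>0. continuous (at_right t) (\<lambda>u. X u w)) \<and>
     (\<forall>n (t :: nat \<Rightarrow> real) (x :: nat \<Rightarrow> nat). \<forall>h\<ge>0. \<forall>j\<in>S.
        0 \<le> t 0 \<longrightarrow> (\<forall>k<n. t k < t (Suc k)) \<longrightarrow>
        \<P>(w in M. \<forall>k\<le>n. X (t k) w = x k) > 0 \<longrightarrow>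
        \<P>(w in M. X (t n + h) w = j \<bar> \<forall>k\<le>n. X (t k) w = x k) = p h (x n) j)"

text \<open>The infimum is taken in the extended reals, so that it is \<open>\<infinity>\<close> for the empty set.\<close>

definition return_or_hit_time :: "(real \<Rightarrow> 'w \<Rightarrow> nat) \<Rightarrow> nat \<Rightarrow> 'w \<Rightarrow> ereal" where
  "return_or_hit_time X e w =
     (if X 0 w = e
      then Inf (ereal ` {t. 0 < t \<and> (\<exists>u. 0 < u \<and> u < t \<and> X u w \<noteq> e) \<and> X t w = e})
      else Inf (ereal ` {t. 0 < t \<and> X t w = e}))"

text \<open>
  \<open>M i\<close> is a law of the process that gives the event \<open>X 0 = i\<close> positive probability, so that
  conditioning on this event makes sense. This covers a single law with a fully supported initial
  distribution (constant \<open>M\<close>) as well as the canonical laws of the chain started in \<open>i\<close>.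
\<close>

definition first_visit_prob ::
    "(nat \<Rightarrow> 'w measure) \<Rightarrow> (real \<Rightarrow> 'w \<Rightarrow> nat) \<Rightarrow> nat \<Rightarrow> nat \<Rightarrow> real" where
  "first_visit_prob M X i e =
     \<P>(w in M i. return_or_hit_time X e w < return_or_hit_time X (3 - e) w \<bar> X 0 w = i)"

definition Q0 :: "(nat \<Rightarrow> nat \<Rightarrow> real) \<Rightarrow> nat \<Rightarrow> nat \<Rightarrow> real" where
  "Q0 Q i j = (if j \<in> {1, 2} then (if i = j then Q i i else 0) else Q i j)"

text \<open>
  States are numbered from 1, whereas the indices of library matrices and vectors start at 0.
\<close>

definition state_mat :: "nat \<Rightarrow> (nat \<Rightarrow> nat \<Rightarrow> real) \<Rightarrow> real mat" where
  "state_mat s A = mat s s (\<lambda>(i, j). A (Suc i) (Suc j))"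

definition state_vec :: "nat \<Rightarrow> (nat \<Rightarrow> real) \<Rightarrow> real Matrix.vec" where
  "state_vec s v = Matrix.vec s (\<lambda>i. v (Suc i))"

end

theory Submission
  imports Defs
begin

text \<open>
  The equations are first-step equations, and they are obtained without the jump chain and without
  the strong Markov property, by observing the chain on the grid of multiples of a small \<open>h\<close>.

  Let \<open>{e, f} = {1, 2}\<close>. The time \<open>\<sigma>\<^sub>e\<close> is, in both cases of its definition, the infimum of the times at which the path is
  in \<open>e\<close> after having been outside \<open>e\<close>; call such a time an entry to \<open>e\<close>. Right-continuity makes
  every visited state persist for a positive time, so a sufficiently fine grid sees the first of the
  two entries (\<open>grid_detects_first_entry\<close>): for each path and all small \<open>h\<close>, the path entered \<open>e\<close>
  before \<open>f\<close> exactly if its restriction to the grid did. Hence the probability of the grid event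
  converges to the probability that is sought (\<open>grid_visit_prob_tendsto\<close>); measurability of the
  limit event comes for free.

  The grid chain has the one-step matrix \<open>p h\<close>, and the grid event only looks for the first step that
  lands in \<open>{e, f}\<close> and changes the state. One step of the chain therefore gives
  \<open>u h i = (\<Sum>j. p h i j * c j)\<close>, where \<open>c j\<close> is \<open>u h j\<close> if \<open>j = i\<close> or \<open>j \<notin> {e, f}\<close>, and otherwise
  \<open>1\<close> or \<open>0\<close> according to \<open>j = e\<close> (\<open>grid_visit_prob_first_step\<close>). Subtracting \<open>u h i\<close>, dividing by
  \<open>h\<close> and letting \<open>h\<close> tend to \<open>0\<close> turns \<open>(p h - I) / h\<close> into \<open>Q\<close>; the case distinction in \<open>c\<close> is the
  one that turns the first two columns of \<open>Q\<close> into those of \<open>Q0 Q\<close>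
  (\<open>first_visit_prob_equation\<close>).

  Uniqueness is a maximum principle (\<open>Q0_kernel_trivial\<close>): the states at which a kernel vector has
  maximal modulus yield a set that no positive rate leaves and that misses state 1 or state 2, which
  contradicts irreducibility. Finally, the two right-hand sides add up to \<open>Q0 Q\<close> applied to the
  constant vector 1, so by uniqueness the two solutions add up to 1.
\<close>

section \<open>Closed sets of states and the kernel of the modified rate matrix\<close>

lemma transition_function_sum_le_one:
  assumes "transition_function S p" and "finite S" and "B \<subseteq> S" and "i \<in> S" and "0 \<le> t"
  shows "(\<Sum>j\<in>B. p t i j) \<le> 1"
proof -
  have "(\<Sum>j\<in>B. p t i j) \<le> (\<Sum>j\<in>S. p t i j)"
    using assms by (intro sum_mono2) (auto simp: transition_function_def)
  then show ?thesis
    using assms by (simp add: transition_function_def)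
qed

text \<open>
  Let \<open>G h\<close> be the sum over the states \<open>k \<in> A\<close> of the probabilities of being outside \<open>A\<close> a time
  \<open>h\<close> after \<open>k\<close>. For a chain that starts in \<open>A\<close>, one of the \<open>n\<close> intervals of length \<open>t / n\<close> has to
  carry it out of \<open>A\<close>, so the probability of being outside \<open>A\<close> at time \<open>t\<close> is at most
  \<open>n * G (t / n)\<close>. This tends to \<open>t\<close> times the total rate out of \<open>A\<close>, that is, to 0.
\<close>

lemma rate_closed_set_never_left:
  assumes tf: "transition_function S p" and tr: "transition_rates S p Q" and fin: "finite S"
    and sub: "A \<subseteq> S" and closed: "\<And>i j. i \<in> A \<Longrightarrow> j \<in> S - A \<Longrightarrow> Q i j = 0"
    and ij: "i \<in> A" "j \<in> S - A" and "0 \<le> t"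
  shows "p t i j = 0"
proof (cases "t = 0")
  case True
  with tf ij sub show ?thesis by (auto simp: transition_function_def)
next
  case False
  with \<open>0 \<le> t\<close> have t: "0 < t" by simp
  define g where "g h k = (\<Sum>l\<in>S - A. p h k l)" for h k
  define G where "G h = (\<Sum>k\<in>A. g h k)" for h
  have nonneg: "0 \<le> p h k l" if "0 \<le> h" "k \<in> S" "l \<in> S" for h k l
    using tf that by (auto simp: transition_function_def)
  have g_nonneg: "0 \<le> g h k" if "0 \<le> h" "k \<in> S" for h k
    unfolding g_def using that nonneg by (intro sum_nonneg) auto
  have g_le_1: "g h k \<le> 1" if "0 \<le> h" "k \<in> S" for h k
    unfolding g_def by (rule transition_function_sum_le_one[OF tf fin _ that(2,1)]) blast
  have g_le_G: "g h k \<le> G h" if "0 \<le> h" "k \<in> A" for h k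
    unfolding G_def using that sub fin g_nonneg
    by (intro member_le_sum) (auto intro: finite_subset)
  have G_nonneg: "0 \<le> G h" if "0 \<le> h" for h
    unfolding G_def using that sub g_nonneg by (intro sum_nonneg) auto
  have steps: "g (real n * h) k \<le> real n * G h" if h: "0 \<le> h" and k: "k \<in> A" for n h k
    using k
  proof (induction n arbitrary: k)
    case 0
    then show ?case
      using tf sub by (auto simp: g_def transition_function_def intro!: sum_nonpos)
  next
    case (Suc n)
    have kS: "k \<in> S" using Suc.prems sub by auto
    have "g (real (Suc n) * h) k = (\<Sum>l\<in>S - A. p (h + real n * h) k l)"
      by (simp add: g_def algebra_simps)
    also have "\<dots> = (\<Sum>l\<in>S - A. \<Sum>m\<in>S. p h k m * p (real n * h) m l)"
      using tf h kS by (intro sum.cong) (auto simp: transition_function_def)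
    also have "\<dots> = (\<Sum>m\<in>S. p h k m * g (real n * h) m)"
      unfolding g_def by (subst sum.swap) (simp add: sum_distrib_left)
    also have "\<dots> = (\<Sum>m\<in>A. p h k m * g (real n * h) m) + (\<Sum>m\<in>S - A. p h k m * g (real n * h) m)"
      using fin sub by (metis add.commute sum.subset_diff)
    also have "(\<Sum>m\<in>A. p h k m * g (real n * h) m) \<le> (\<Sum>m\<in>A. p h k m * (real n * G h))"
      using Suc.IH h kS sub nonneg by (intro sum_mono mult_left_mono) auto
    also have "(\<Sum>m\<in>A. p h k m * (real n * G h)) = (\<Sum>m\<in>A. p h k m) * (real n * G h)"
      by (simp add: sum_distrib_right)
    also have "\<dots> \<le> 1 * (real n * G h)"
      using transition_function_sum_le_one[OF tf fin sub kS h] G_nonneg[OF h]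
      by (intro mult_right_mono) auto
    also have "(\<Sum>m\<in>S - A. p h k m * g (real n * h) m) \<le> (\<Sum>m\<in>S - A. p h k m * 1)"
      using h kS nonneg g_le_1 by (intro sum_mono mult_left_mono) auto
    also have "(\<Sum>m\<in>S - A. p h k m * 1) \<le> G h"
      using g_le_G[OF h Suc.prems] by (simp add: g_def)
    finally show ?case by (simp add: algebra_simps)
  qed
  have rate: "((\<lambda>h. p h k l / h) \<longlongrightarrow> Q k l) (at_right 0)" if "k \<in> A" "l \<in> S - A" for k l
  proof -
    have "k \<in> S" "l \<in> S" "k \<noteq> l" using that sub by auto
    with tr show ?thesis unfolding transition_rates_def by blast
  qed
  have lim: "((\<lambda>h. G h / h) \<longlongrightarrow> (\<Sum>k\<in>A. \<Sum>l\<in>S - A. Q k l)) (at_right 0)"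
    unfolding G_def g_def sum_divide_distrib
    by (intro tendsto_sum rate)
  have "filterlim (\<lambda>n. t / real (Suc n)) (at_right 0) sequentially"
    using t by real_asymp
  from filterlim_compose[OF lim this]
  have "(\<lambda>n. G (t / real (Suc n)) / (t / real (Suc n))) \<longlonglongrightarrow> 0"
    using closed by (simp add: sum.neutral)
  then have "(\<lambda>n. t * (G (t / real (Suc n)) / (t / real (Suc n)))) \<longlonglongrightarrow> t * 0"
    by (intro tendsto_intros)
  moreover have "p t i j \<le> t * (G (t / real (Suc n)) / (t / real (Suc n)))" for n
  proof -
    have "p t i j \<le> g t i"
      unfolding g_def using ij sub fin nonneg t by (intro member_le_sum) auto
    also have "\<dots> \<le> real (Suc n) * G (t / real (Suc n))"
      using steps[of "t / real (Suc n)" i "Suc n"] t ij by (simp del: of_nat_Suc)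
    also have "\<dots> = t * (G (t / real (Suc n)) / (t / real (Suc n)))"
      using t by simp
    finally show ?thesis .
  qed
  ultimately have "p t i j \<le> t * 0"
    by (intro LIMSEQ_le_const) auto
  with nonneg[of t i j] ij sub t show ?thesis by auto
qed

lemma irreducible_leaves_proper_subset:
  assumes "transition_function S p" and tr: "transition_rates S p Q" and "finite S"
    and irr: "irreducible_chain S p" and A: "A \<subseteq> S" "A \<noteq> {}" "A \<noteq> S"
  shows "\<exists>i\<in>A. \<exists>j\<in>S - A. 0 < Q i j"
proof (rule ccontr)
  assume no: "\<not> ?thesis"
  have closed: "Q i j = 0" if "i \<in> A" "j \<in> S - A" for i j
  proof -
    have "i \<in> S" "j \<in> S" "i \<noteq> j" using that A(1) by auto
    then have "0 \<le> Q i j" using tr unfolding transition_rates_def by blast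
    moreover have "\<not> 0 < Q i j" using no that by blast
    ultimately show ?thesis by simp
  qed
  obtain i j where ij: "i \<in> A" "j \<in> S - A" using A by blast
  then obtain t where "0 \<le> t" "0 < p t i j"
    using irr A(1) unfolding irreducible_chain_def by blast
  with rate_closed_set_never_left[OF assms(1-3) A(1) closed ij] show False by simp
qed

text \<open>
  At a state \<open>i\<close> where \<open>\<bar>v\<bar>\<close> attains its maximum \<open>m\<close>, the row equation bounds \<open>\<bar>Q i i\<bar> * m\<close> by the
  sum of \<open>Q i j * \<bar>v j\<bar>\<close> over \<open>j \<notin> {1, 2, i}\<close>, whereas \<open>\<bar>Q i i\<bar>\<close> is the sum of all rates out of \<open>i\<close>.
  Equality must hold throughout, so positive rates lead only to maximal states outside \<open>{1, 2}\<close>.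
\<close>

lemma Q0_kernel_trivial:
  assumes tf: "transition_function S p" and tr: "transition_rates S p Q" and fin: "finite S"
    and irr: "irreducible_chain S p" and S12: "1 \<in> S" "2 \<in> S"
    and ker: "\<And>i. i \<in> S \<Longrightarrow> (\<Sum>j\<in>S. Q0 Q i j * v j) = 0"
    and k: "k \<in> S"
  shows "v k = 0"
proof (rule ccontr)
  assume "v k \<noteq> 0"
  define m where "m = Max ((\<lambda>i. \<bar>v i\<bar>) ` S)"
  have le_m: "\<bar>v i\<bar> \<le> m" if "i \<in> S" for i
    using that fin by (auto simp: m_def)
  have "0 < m" using le_m[OF k] \<open>v k \<noteq> 0\<close> by linarith
  have "m \<in> (\<lambda>i. \<bar>v i\<bar>) ` S"
    unfolding m_def using fin k by (intro Max_in) auto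
  then obtain a where a: "a \<in> S" "\<bar>v a\<bar> = m" by auto
  have Q_nonneg: "0 \<le> Q i j" if "i \<in> S" "j \<in> S" "i \<noteq> j" for i j
    using tr that by (auto simp: transition_rates_def)
  have step: "j \<notin> {1, 2} \<and> \<bar>v j\<bar> = m"
    if i: "i \<in> S" "\<bar>v i\<bar> = m" and j: "j \<in> S" "j \<noteq> i" "0 < Q i j" for i j
  proof -
    have diag: "Q i i = - (\<Sum>l\<in>S - {i}. Q i l)"
      using tr i by (auto simp: transition_rates_def)
    have row_nonneg: "0 \<le> (\<Sum>l\<in>S - {i}. Q i l)"
      using Q_nonneg i by (intro sum_nonneg) auto
    have "Q i i * v i = - (\<Sum>l\<in>S - {i}. Q0 Q i l * v l)"
      using ker[OF i(1)] sum.remove[OF fin i(1), of "\<lambda>l. Q0 Q i l * v l"]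
      by (simp add: Q0_def[of Q i i] eq_neg_iff_add_eq_0 split: if_splits)
    then have "\<bar>Q i i\<bar> * m = \<bar>\<Sum>l\<in>S - {i}. Q0 Q i l * v l\<bar>"
      using i(2) by (metis abs_minus_cancel abs_mult)
    also have "\<dots> \<le> (\<Sum>l\<in>S - {i}. \<bar>Q0 Q i l * v l\<bar>)" by (rule sum_abs)
    finally have "(\<Sum>l\<in>S - {i}. Q i l * m - \<bar>Q0 Q i l * v l\<bar>) \<le> 0"
      using row_nonneg by (simp add: diag sum_subtractf sum_distrib_right[symmetric])
    moreover have term_nonneg: "0 \<le> Q i l * m - \<bar>Q0 Q i l * v l\<bar>" if "l \<in> S - {i}" for l
      using that Q_nonneg[of i l] i(1) le_m[of l] \<open>0 < m\<close>
      by (auto simp: Q0_def abs_mult intro: mult_left_mono)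
    ultimately have "Q i j * m - \<bar>Q0 Q i j * v j\<bar> \<le> 0"
      using member_le_sum[of j "S - {i}" "\<lambda>l. Q i l * m - \<bar>Q0 Q i l * v l\<bar>"] fin j by force
    then show ?thesis
      using j \<open>0 < m\<close> le_m[OF j(1)]
      by (auto simp: Q0_def abs_mult split: if_splits)
         (metis mult_pos_pos not_le)+
  qed
  \<comment> \<open>Besides the starting point \<open>a\<close>, only states outside \<open>{1, 2}\<close> are admitted, so \<open>B\<close> misses 1 or 2.\<close>
  define B where "B = insert a {i \<in> S - {1, 2}. \<bar>v i\<bar> = m}"
  have "B \<subseteq> S" "B \<noteq> {}" using a by (auto simp: B_def)
  moreover have "B \<noteq> S"
  proof
    assume "B = S"
    with S12 have "a = 1" "a = 2" by (auto simp: B_def)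
    then show False by simp
  qed
  ultimately obtain i j where "i \<in> B" "j \<in> S - B" "0 < Q i j"
    using irreducible_leaves_proper_subset[OF tf tr fin irr, of B] by blast
  with step[of i j] a show False by (auto simp: B_def)
qed

text \<open>
  On the diagonal the limit comes from the rows: those of \<open>p h\<close> sum to 1 and those of \<open>Q\<close> to 0.
\<close>

lemma transition_function_has_generator:
  assumes tf: "transition_function S p" and tr: "transition_rates S p Q" and fin: "finite S"
    and i: "i \<in> S" and j: "j \<in> S"
  shows "((\<lambda>h. (p h i j - of_bool (i = j)) / h) \<longlongrightarrow> Q i j) (at_right 0)"
proof (cases "i = j")
  case False
  then show ?thesis using tr i j by (auto simp: transition_rates_def)
next
  case True
  have "((\<lambda>h. - (\<Sum>l\<in>S - {i}. p h i l / h)) \<longlongrightarrow> - (\<Sum>l\<in>S - {i}. Q i l)) (at_right 0)"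
    using tr i by (intro tendsto_intros) (auto simp: transition_rates_def)
  also have "- (\<Sum>l\<in>S - {i}. Q i l) = Q i j"
    using tr i True by (auto simp: transition_rates_def)
  finally show ?thesis
  proof (rule Lim_transform_eventually)
    show "\<forall>\<^sub>F h in at_right 0. - (\<Sum>l\<in>S - {i}. p h i l / h) = (p h i j - of_bool (i = j)) / h"
    proof (rule eventually_at_right_less[THEN eventually_mono])
      fix h :: real assume "0 < h"
      then have "p h i i + (\<Sum>l\<in>S - {i}. p h i l) = 1"
        using tf i sum.remove[OF fin i, of "p h i"] by (simp add: transition_function_def)
      then show "- (\<Sum>l\<in>S - {i}. p h i l / h) = (p h i j - of_bool (i = j)) / h"
        unfolding True[symmetric] sum_divide_distrib[symmetric] minus_divide_left
        by (intro arg_cong[where f="\<lambda>y. y / h"]) simp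
    qed
  qed
qed

section \<open>Entries in continuous time and on a grid\<close>

text \<open>
  The index set \<open>T\<close> is \<open>{0..}\<close> for paths, because their values at negative times are arbitrary, and
  \<open>UNIV\<close> for sequences of grid values. If \<open>x\<close> starts in \<open>e\<close>, an entry is a time spent in \<open>e\<close> after
  having left it; otherwise it is any time spent in \<open>e\<close>.
\<close>

definition entry :: "nat \<Rightarrow> ('t::linorder \<Rightarrow> nat) \<Rightarrow> 't set \<Rightarrow> 't \<Rightarrow> bool" where
  "entry e x T t \<longleftrightarrow> t \<in> T \<and> x t = e \<and> (\<exists>u\<in>T. u < t \<and> x u \<noteq> e)"

text \<open>The horizon \<open>N\<close> makes this an event about finitely many coordinates, accessible to induction.\<close>

definition enters_first :: "nat \<Rightarrow> nat \<Rightarrow> (nat \<Rightarrow> nat) \<Rightarrow> nat \<Rightarrow> bool" where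
  "enters_first e f x N \<longleftrightarrow> (\<exists>n\<le>N. entry e x UNIV n \<and> (\<forall>k\<le>n. \<not> entry f x UNIV k))"

text \<open>
  Dropping the first value loses no entry to \<open>e\<close>: if the first value is the witness outside \<open>e\<close>, the
  second one is outside \<open>e\<close> as well.
\<close>

lemma entry_nat_Suc:
  assumes "x (Suc 0) = x 0 \<or> x (Suc 0) \<noteq> e"
  shows "entry e x UNIV (Suc n) \<longleftrightarrow> entry e (\<lambda>k. x (Suc k)) UNIV n"
proof
  assume "entry e x UNIV (Suc n)"
  then obtain u where u: "x (Suc n) = e" "u < Suc n" "x u \<noteq> e" by (auto simp: entry_def)
  show "entry e (\<lambda>k. x (Suc k)) UNIV n"
  proof (cases u)
    case 0
    with u assms have "x (Suc 0) \<noteq> e" by auto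
    with u(1) have "0 < n" by (cases n) auto
    with u \<open>x (Suc 0) \<noteq> e\<close> show ?thesis by (auto simp: entry_def)
  next
    case (Suc v)
    with u show ?thesis by (auto simp: entry_def)
  qed
qed (auto simp: entry_def)

text \<open>
  A first step that changes the state and lands in \<open>{e, f}\<close> is itself the first entry and decides the
  event. After any other step the event depends only on the remaining values.
\<close>

lemma enters_first_Suc:
  assumes "e \<noteq> f"
  shows "enters_first e f x (Suc N) \<longleftrightarrow>
    (if x (Suc 0) = x 0 \<or> x (Suc 0) \<notin> {e, f} then enters_first e f (\<lambda>k. x (Suc k)) N
     else x (Suc 0) = e)"
proof -
  have zero: "\<not> entry c x UNIV 0" for c by (simp add: entry_def)
  have un: "enters_first e f x (Suc N) \<longleftrightarrow>
      (\<exists>n\<le>N. entry e x UNIV (Suc n) \<and> (\<forall>k\<le>n. \<not> entry f x UNIV (Suc k)))"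
  proof -
    have "(\<exists>n\<le>Suc N. P n) \<longleftrightarrow> P 0 \<or> (\<exists>n\<le>N. P (Suc n))" for P :: "nat \<Rightarrow> bool"
      by (metis Suc_le_mono le0 not0_implies_Suc)
    moreover have "(\<forall>k\<le>Suc n. P k) \<longleftrightarrow> P 0 \<and> (\<forall>k\<le>n. P (Suc k))" for n and P :: "nat \<Rightarrow> bool"
      by (metis Suc_le_mono le0 not0_implies_Suc)
    ultimately show ?thesis
      unfolding enters_first_def by (simp add: zero)
  qed
  show ?thesis
  proof (cases "x (Suc 0) = x 0 \<or> x (Suc 0) \<notin> {e, f}")
    case True
    then show ?thesis
      unfolding un using entry_nat_Suc[of x e] entry_nat_Suc[of x f]
      by (auto simp: enters_first_def)
  next
    case False
    then have one: "entry c x UNIV (Suc 0) \<longleftrightarrow> x (Suc 0) = c" for c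
      by (auto simp: entry_def)
    show ?thesis
    proof (cases "x (Suc 0) = e")
      case True
      then show ?thesis
        unfolding un using False one assms by auto
    next
      case False2: False
      then have "entry f x UNIV (Suc 0)" using False one by auto
      then show ?thesis
        unfolding un using False False2 by auto
    qed
  qed
qed

lemma enters_first_mono: "enters_first e f x N \<Longrightarrow> N \<le> N' \<Longrightarrow> enters_first e f x N'"
  unfolding enters_first_def by (meson order_trans)

lemma return_or_hit_time_eq_Inf_entry:
  "return_or_hit_time X e w = Inf (ereal ` Collect (entry e (\<lambda>t. X t w) {0..}))"
proof (cases "X 0 w = e")
  case True
  have "{t. 0 < t \<and> (\<exists>u. 0 < u \<and> u < t \<and> X u w \<noteq> e) \<and> X t w = e}
      = Collect (entry e (\<lambda>t. X t w) {0..})"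
    using True by (auto simp: entry_def) (metis atLeast_iff less_le)+
  with True show ?thesis by (simp add: return_or_hit_time_def)
next
  case False
  have "{t. 0 < t \<and> X t w = e} = Collect (entry e (\<lambda>t. X t w) {0..})"
    using False by (auto simp: entry_def)
  with False show ?thesis by (simp add: return_or_hit_time_def)
qed

text \<open>Right-continuity of paths with discrete values, spelled out on nonnegative times.\<close>

definition right_constant :: "(real \<Rightarrow> nat) \<Rightarrow> bool" where
  "right_constant x \<longleftrightarrow> (\<forall>t\<ge>0. \<exists>d>0. \<forall>u. t \<le> u \<and> u < t + d \<longrightarrow> x u = x t)"

lemma right_constantI:
  assumes "\<And>t. 0 \<le> t \<Longrightarrow> continuous (at_right t) x"
  shows "right_constant x"
  unfolding right_constant_def
proof (intro allI impI)
  fix t :: real assume "0 \<le> t"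
  then have "\<forall>\<^sub>F u in at_right t. x u = x t"
    using assms by (simp add: continuous_within tendsto_discrete)
  then obtain b where b: "t < b" "\<And>u. t < u \<Longrightarrow> u < b \<Longrightarrow> x u = x t"
    by (auto simp: eventually_at_right_field)
  show "\<exists>d>0. \<forall>u. t \<le> u \<and> u < t + d \<longrightarrow> x u = x t"
    using b by (intro exI[of _ "b - t"]) (auto simp: less_eq_real_def)
qed

lemma grid_point_in_interval:
  fixes h a d :: real
  assumes "0 \<le> a" "0 < h" "h < d"
  shows "\<exists>n::nat. a \<le> real n * h \<and> real n * h < a + d"
proof -
  define n where "n = nat \<lceil>a / h\<rceil>"
  have "a / h \<le> real n" "real n < a / h + 1"
    using assms by (auto simp: n_def) (linarith+)
  then show ?thesis
    using assms by (intro exI[of _ n]) (auto simp: field_simps)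
qed

lemma grid_entry:
  assumes "0 < h" and "entry e (\<lambda>k. x (real k * h)) UNIV n"
  shows "entry e x {0..} (real n * h)"
proof -
  obtain m where "m < n" "x (real m * h) \<noteq> e" "x (real n * h) = e"
    using assms(2) by (auto simp: entry_def)
  moreover have "real m * h < real n * h" using \<open>m < n\<close> assms(1) by simp
  moreover have "0 \<le> real k * h" for k using assms(1) by simp
  ultimately show ?thesis unfolding entry_def by (metis atLeast_iff)
qed

text \<open>
  Some entry \<open>t\<close> to \<open>e\<close> precedes all entries to \<open>f\<close>. The path stays in \<open>e\<close> for a while after \<open>t\<close>, and
  outside \<open>e\<close> for a while after some earlier time \<open>u\<close>. A grid finer than both periods has a point in
  each of them and hence sees an entry to \<open>e\<close>; every entry on the grid is one of the path, so none to
  \<open>f\<close> is seen before.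
\<close>

lemma earlier_entry_seen_on_grid:
  assumes rc: "right_constant x"
    and less: "Inf (ereal ` Collect (entry e x {0..})) < Inf (ereal ` Collect (entry f x {0..}))"
      (is "?a < ?b")
  shows "\<exists>d>0. \<forall>h. 0 < h \<and> h < d \<longrightarrow> (\<exists>N. enters_first e f (\<lambda>k. x (real k * h)) N)"
proof -
  from less obtain t where t: "entry e x {0..} t" "ereal t < ?b"
    by (auto simp: Inf_less_iff)
  then obtain u where u: "0 \<le> u" "u < t" "x u \<noteq> e" and xt: "x t = e" "0 \<le> t"
    by (auto simp: entry_def)
  from ereal_dense2[OF t(2)] obtain c where c: "t < c" "ereal c < ?b" by auto
  obtain d1 where d1: "d1 > 0" "\<And>r. t \<le> r \<Longrightarrow> r < t + d1 \<Longrightarrow> x r = e"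
    using rc xt unfolding right_constant_def by metis
  obtain d2 where d2: "d2 > 0" "\<And>r. u \<le> r \<Longrightarrow> r < u + d2 \<Longrightarrow> x r \<noteq> e"
    using rc u unfolding right_constant_def by metis
  \<comment> \<open>The bound \<open>c - t\<close> keeps the grid point before all entries to \<open>f\<close>, and \<open>t - u\<close> keeps the two grid points in order.\<close>
  define d where "d = min (min d1 (c - t)) (min d2 (t - u))"
  have "d > 0" using d1 d2 c u by (simp add: d_def)
  moreover have "\<exists>N. enters_first e f (\<lambda>k. x (real k * h)) N" if h: "0 < h" "h < d" for h
  proof -
    obtain n where n: "t \<le> real n * h" "real n * h < t + d"
      using grid_point_in_interval[of t h d] h xt by blast
    obtain m where m: "u \<le> real m * h" "real m * h < u + d"
      using grid_point_in_interval[of u h d] h u by blast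
    have "real m * h < real n * h" using n m by (simp add: d_def)
    then have "m < n" using h by simp
    have x_n: "x (real n * h) = e" using n by (intro d1(2)) (auto simp: d_def)
    have x_m: "x (real m * h) \<noteq> e" using m by (intro d2(2)) (auto simp: d_def)
    have "entry e (\<lambda>k. x (real k * h)) UNIV n"
      using \<open>m < n\<close> x_n x_m by (auto simp: entry_def)
    moreover have "\<not> entry f (\<lambda>k. x (real k * h)) UNIV k" if "k \<le> n" for k
    proof
      assume "entry f (\<lambda>k. x (real k * h)) UNIV k"
      then have "?b \<le> ereal (real k * h)"
        using h by (intro Inf_lower) (auto intro: grid_entry)
      moreover have "real k * h \<le> real n * h" using that h by simp
      ultimately have "?b \<le> ereal c"
        using n by (elim order_trans) (simp add: d_def)
      with c(2) show False by simp
    qed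
    ultimately show ?thesis by (auto simp: enters_first_def)
  qed
  ultimately show ?thesis by blast
qed

text \<open>
  There are entries at \<open>c\<close> or arbitrarily shortly after \<open>c\<close>, where the path still has its value at
  \<open>c\<close>. In particular, first entries to different states cannot coincide.
\<close>

lemma Inf_entry_attained:
  assumes rc: "right_constant x" and c: "Inf (ereal ` Collect (entry e x {0..})) = ereal c"
  shows "0 \<le> c \<and> x c = e"
proof -
  have lb: "c \<le> t" if "entry e x {0..} t" for t
    using Inf_lower[of "ereal t" "ereal ` Collect (entry e x {0..})"] c that by auto
  have "ereal 0 \<le> Inf (ereal ` Collect (entry e x {0..}))"
    by (intro Inf_greatest) (auto simp: entry_def)
  with c have "0 \<le> c" by simp
  then obtain d where d: "d > 0" "\<And>r. c \<le> r \<Longrightarrow> r < c + d \<Longrightarrow> x r = x c"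
    using rc unfolding right_constant_def by metis
  have "Inf (ereal ` Collect (entry e x {0..})) < ereal (c + d)"
    using c d by simp
  then obtain t where t: "entry e x {0..} t" "t < c + d" by (auto simp: Inf_less_iff)
  then have "x t = x c" by (intro d(2) lb)
  moreover have "x t = e" using t(1) by (simp add: entry_def)
  ultimately show ?thesis
    using \<open>0 \<le> c\<close> by simp
qed

lemma grid_detects_first_entry:
  assumes rc: "right_constant x" and "e \<noteq> f"
  shows "\<forall>\<^sub>F h in at_right 0. (\<exists>N. enters_first e f (\<lambda>k. x (real k * h)) N) \<longleftrightarrow>
    Inf (ereal ` Collect (entry e x {0..})) < Inf (ereal ` Collect (entry f x {0..}))"
    (is "\<forall>\<^sub>F h in _. ?D h \<longleftrightarrow> ?a < ?b")
proof -
  consider "?a < ?b" | "?b < ?a" | "?a = ?b" by (rule linorder_cases)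
  then show ?thesis
  proof cases
    case 1
    then show ?thesis
      using earlier_entry_seen_on_grid[OF rc 1] by (auto simp: eventually_at_right_field)
  next
    case 2
    then obtain d where d: "d > 0"
      "\<And>h. 0 < h \<Longrightarrow> h < d \<Longrightarrow> \<exists>N. enters_first f e (\<lambda>k. x (real k * h)) N"
      using earlier_entry_seen_on_grid[OF rc 2] by blast
    have "\<not> ?D h" if "0 < h" "h < d" for h
      using d(2)[OF that] unfolding enters_first_def by (meson nle_le)
    with d(1) 2 show ?thesis
      by (auto simp: eventually_at_right_field)
  next
    case 3
    \<comment> \<open>A common finite value would be a time at which the path is both in \<open>e\<close> and in \<open>f\<close>.\<close>
    have "?a = \<infinity>"
    proof (cases ?a)
      case (real c)
      with Inf_entry_attained[OF rc, of e c] Inf_entry_attained[OF rc, of f c] 3 \<open>e \<noteq> f\<close>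
      show ?thesis by simp
    next
      case MInf
      have "ereal 0 \<le> ?a" by (intro Inf_greatest) (auto simp: entry_def)
      with MInf show ?thesis by simp
    qed
    have "\<not> ?D h" if "0 < h" for h
    proof
      assume "?D h"
      then obtain n where n: "entry e (\<lambda>k. x (real k * h)) UNIV n"
        by (auto simp: enters_first_def)
      have "entry e x {0..} (real n * h)"
        by (rule grid_entry[OF that n])
      then have "?a \<le> ereal (real n * h)" by (intro Inf_lower) auto
      with \<open>?a = \<infinity>\<close> show False by simp
    qed
    with 3 show ?thesis
      by (auto simp: eventually_at_right_field intro: exI[of _ 1])
  qed
qed

section \<open>The chain observed on a grid\<close>

text \<open>
  The probability that a discrete-time chain with one-step matrix \<open>P\<close>, started in \<open>i\<close>, enters \<open>e\<close>
  before \<open>f\<close> within \<open>N\<close> steps. The case distinction is that of \<open>enters_first_Suc\<close>.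
\<close>

primrec entry_prob :: "nat set \<Rightarrow> (nat \<Rightarrow> nat \<Rightarrow> real) \<Rightarrow> nat \<Rightarrow> nat \<Rightarrow> nat \<Rightarrow> nat \<Rightarrow> real" where
  "entry_prob S P e f 0 i = 0"
| "entry_prob S P e f (Suc N) i =
     (\<Sum>j\<in>S. P i j * (if j = i \<or> j \<notin> {e, f} then entry_prob S P e f N j else of_bool (j = e)))"

lemma ctmc_measurable:
  "ctmc S p M X \<Longrightarrow> 0 \<le> t \<Longrightarrow> X t \<in> measurable M (count_space UNIV)"
  by (auto simp: ctmc_def intro: measurable_compose[where N="count_space S" and g="\<lambda>x. x"])

lemma enters_first_measurable:
  assumes "ctmc S p M X" and "0 < h"
  shows "{w \<in> space M. enters_first e f (\<lambda>k. X (real (n + k) * h) w) N} \<in> sets M"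
proof -
  have [measurable]: "X (real k * h) \<in> measurable M (count_space UNIV)" for k
    using assms by (intro ctmc_measurable) auto
  show ?thesis
    unfolding enters_first_def entry_def by measurable
qed

lemma prob_prefix_step:
  assumes ct: "ctmc S p M X" and h: "0 < h" and j: "x (Suc n) \<in> S"
  shows "\<P>(w in M. \<forall>k\<le>Suc n. X (real k * h) w = x k) =
    \<P>(w in M. \<forall>k\<le>n. X (real k * h) w = x k) * p h (x n) (x (Suc n))"
proof -
  interpret prob_space M using ct by (simp add: ctmc_def)
  have [measurable]: "X (real k * h) \<in> measurable M (count_space UNIV)" for k
    using ct h by (intro ctmc_measurable) auto
  let ?A = "{w \<in> space M. \<forall>k\<le>n. X (real k * h) w = x k}"
  let ?B = "{w \<in> space M. \<forall>k\<le>Suc n. X (real k * h) w = x k}"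
  have A[measurable]: "?A \<in> sets M" by measurable
  have BA: "?B \<subseteq> ?A" by auto
  show ?thesis
  proof (cases "prob ?A = 0")
    case True
    then have "prob ?B = 0"
      using finite_measure_mono[OF BA A] by (simp add: measure_le_0_iff)
    with True show ?thesis by simp
  next
    case False
    then have pos: "0 < prob ?A" by (simp add: zero_less_measure_iff)
    have "\<P>(w in M. X (real n * h + h) w = x (Suc n) \<bar> \<forall>k\<le>n. X (real k * h) w = x k)
        = p h (x n) (x (Suc n))"
      using ct pos h j unfolding ctmc_def
      by (elim conjE allE[of _ n] allE[of _ "\<lambda>k. real k * h"] allE[of _ x] allE[of _ h])
         (auto simp: algebra_simps)
    moreover have "{w \<in> space M. X (real n * h + h) w = x (Suc n) \<and> (\<forall>k\<le>n. X (real k * h) w = x k)} = ?B"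
      by (auto simp: le_Suc_eq algebra_simps)
    ultimately show ?thesis
      using pos by (simp add: cond_prob_def field_simps)
  qed
qed

text \<open>
  The Markov property for the future on the grid. The induction over the horizon \<open>N\<close> extends the
  prescribed past by one value; this is why the past has arbitrary length, although only the length
  \<open>n = 0\<close> matters in the end.
\<close>

lemma prob_enters_first_after_prefix:
  assumes ct: "ctmc S p M X" and fin: "finite S" and h: "0 < h" and ef: "e \<noteq> f"
  shows "\<P>(w in M. (\<forall>k\<le>n. X (real k * h) w = x k) \<and>
            enters_first e f (\<lambda>k. X (real (n + k) * h) w) N) =
    \<P>(w in M. \<forall>k\<le>n. X (real k * h) w = x k) * entry_prob S (p h) e f N (x n)"
proof (induction N arbitrary: n x)
  case 0
  then show ?case by (simp add: enters_first_def entry_def)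
next
  case (Suc N)
  interpret prob_space M using ct by (simp add: ctmc_def)
  have [measurable]: "X (real k * h) \<in> measurable M (count_space UNIV)" for k
    using ct h by (intro ctmc_measurable) auto
  let ?pre = "\<lambda>n x w. \<forall>k\<le>n. X (real k * h) w = x k"
  let ?acc = "\<lambda>n N w. enters_first e f (\<lambda>k. X (real (n + k) * h) w) N"
  define y where "y j = x(Suc n := j)" for j
  let ?E = "{w \<in> space M. ?pre n x w \<and> ?acc n (Suc N) w}"
  let ?F = "\<lambda>j. {w \<in> space M. ?pre (Suc n) (y j) w \<and> ?acc n (Suc N) w}"
  have pre_y: "?pre (Suc n) (y j) w \<longleftrightarrow> ?pre n x w \<and> X (real (Suc n) * h) w = j" for j w
    by (auto simp: y_def le_Suc_eq)
  have inS: "X (real (Suc n) * h) w \<in> S" if "w \<in> space M" for w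
  proof -
    have "X (real (Suc n) * h) \<in> measurable M (count_space S)"
      using ct h by (simp add: ctmc_def)
    from measurable_space[OF this that] show ?thesis by simp
  qed
  have F_sets: "\<forall>j\<in>S. ?F j \<in> sets M"
  proof
    fix j
    have [measurable]: "{w \<in> space M. ?acc n (Suc N) w} \<in> sets M"
      by (rule enters_first_measurable[OF ct h])
    show "?F j \<in> sets M" by measurable
  qed
  have acc: "?acc n (Suc N) w \<longleftrightarrow>
      (if X (real (Suc n) * h) w = X (real n * h) w \<or> X (real (Suc n) * h) w \<notin> {e, f}
       then ?acc (Suc n) N w else X (real (Suc n) * h) w = e)" for w
    using enters_first_Suc[OF ef, of "\<lambda>k. X (real (n + k) * h) w" N]
    by (simp del: of_nat_Suc)
  have "?E = (\<Union>j\<in>S. ?F j)"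
    unfolding pre_y using inS by blast
  moreover have "disjoint_family_on ?F S"
    unfolding disjoint_family_on_def pre_y by blast
  ultimately have "prob ?E = (\<Sum>j\<in>S. prob (?F j))"
    using finite_measure_finite_Union[OF fin, of ?F] F_sets by (simp only: image_subset_iff)
  also have "\<dots> = (\<Sum>j\<in>S. prob {w \<in> space M. ?pre n x w} * (p h (x n) j *
      (if j = x n \<or> j \<notin> {e, f} then entry_prob S (p h) e f N j else of_bool (j = e))))"
  proof (intro sum.cong refl)
    fix j assume j: "j \<in> S"
    have step: "prob {w \<in> space M. ?pre (Suc n) (y j) w} = prob {w \<in> space M. ?pre n x w} * p h (x n) j"
      using prob_prefix_step[OF ct h, of "y j" n] j by (simp add: y_def)
    have split: "?F j = {w \<in> space M. ?pre (Suc n) (y j) w \<and>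
        (if j = x n \<or> j \<notin> {e, f} then ?acc (Suc n) N w else j = e)}"
    proof (rule Collect_cong)
      fix w
      show "w \<in> space M \<and> ?pre (Suc n) (y j) w \<and> ?acc n (Suc N) w \<longleftrightarrow>
        w \<in> space M \<and> ?pre (Suc n) (y j) w \<and>
          (if j = x n \<or> j \<notin> {e, f} then ?acc (Suc n) N w else j = e)"
      proof (cases "?pre (Suc n) (y j) w")
        case True
        then have "X (real (Suc n) * h) w = j" "X (real n * h) w = x n"
          unfolding pre_y by auto
        then show ?thesis unfolding acc by (simp del: of_nat_Suc)
      qed blast
    qed
    show "prob (?F j) = prob {w \<in> space M. ?pre n x w} * (p h (x n) j *
      (if j = x n \<or> j \<notin> {e, f} then entry_prob S (p h) e f N j else of_bool (j = e)))"
    proof (cases "j = x n \<or> j \<notin> {e, f}")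
      case True
      then show ?thesis
        unfolding split using Suc.IH[of "Suc n" "y j"] step by (simp add: y_def)
    next
      case False
      then show ?thesis
        unfolding split using step by (cases "j = e") simp_all
    qed
  qed
  also have "\<dots> = prob {w \<in> space M. ?pre n x w} * entry_prob S (p h) e f (Suc N) (x n)"
    by (simp only: entry_prob.simps sum_distrib_left)
  finally show ?case .
qed

definition grid_visit_prob :: "'w measure \<Rightarrow> (real \<Rightarrow> 'w \<Rightarrow> nat) \<Rightarrow> nat \<Rightarrow> nat \<Rightarrow> real \<Rightarrow> nat \<Rightarrow> real" where
  "grid_visit_prob M X e f h i =
     \<P>(w in M. (\<exists>N. enters_first e f (\<lambda>k. X (real k * h) w) N) \<bar> X 0 w = i)"

lemma entry_prob_tendsto_grid_visit_prob:
  assumes ct: "ctmc S p M X" and fin: "finite S" and h: "0 < h" and ef: "e \<noteq> f"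
    and pos: "0 < \<P>(w in M. X 0 w = i)"
  shows "(\<lambda>N. entry_prob S (p h) e f N i) \<longlonglongrightarrow> grid_visit_prob M X e f h i"
proof -
  interpret prob_space M using ct by (simp add: ctmc_def)
  have [measurable]: "X 0 \<in> measurable M (count_space UNIV)"
    using ct by (intro ctmc_measurable) auto
  have [measurable]: "{w \<in> space M. enters_first e f (\<lambda>k. X (real k * h) w) N} \<in> sets M" for N
    using enters_first_measurable[OF ct h, of e f 0 N] by simp
  define A where "A N = {w \<in> space M. X 0 w = i \<and> enters_first e f (\<lambda>k. X (real k * h) w) N}" for N
  have "range A \<subseteq> sets M" unfolding A_def by auto
  moreover have "incseq A"
    by (auto simp: incseq_def A_def intro: enters_first_mono)
  ultimately have "(\<lambda>N. prob (A N)) \<longlonglongrightarrow> prob (\<Union>N. A N)"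
    by (rule finite_Lim_measure_incseq)
  then have "(\<lambda>N. prob (A N) / prob {w \<in> space M. X 0 w = i}) \<longlonglongrightarrow>
      prob (\<Union>N. A N) / prob {w \<in> space M. X 0 w = i}"
    using pos by (intro tendsto_intros) auto
  moreover have "prob (A N) / prob {w \<in> space M. X 0 w = i} = entry_prob S (p h) e f N i" for N
    using prob_enters_first_after_prefix[OF ct fin h ef, of 0 "\<lambda>_. i" N] pos by (simp add: A_def)
  moreover have "(\<Union>N. A N) =
      {w \<in> space M. (\<exists>N. enters_first e f (\<lambda>k. X (real k * h) w) N) \<and> X 0 w = i}"
    by (auto simp: A_def)
  ultimately show ?thesis by (simp add: grid_visit_prob_def cond_prob_def)
qed

text \<open>
  The recursion of \<open>entry_prob\<close> in the limit of an infinite horizon. The value at \<open>j\<close> may be computed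
  under a law of its own, since it depends on the transition function only.
\<close>

lemma grid_visit_prob_first_step:
  assumes fin: "finite S" and h: "0 < h" and ef: "e \<noteq> f" and i: "i \<in> S"
    and ct: "\<And>i. i \<in> S \<Longrightarrow> ctmc S p (M i) X"
    and pos: "\<And>i. i \<in> S \<Longrightarrow> 0 < \<P>(w in M i. X 0 w = i)"
  shows "grid_visit_prob (M i) X e f h i =
    (\<Sum>j\<in>S. p h i j * (if j = i \<or> j \<notin> {e, f} then grid_visit_prob (M j) X e f h j
                       else of_bool (j = e)))"
proof (rule LIMSEQ_unique)
  have lim: "(\<lambda>N. entry_prob S (p h) e f N j) \<longlonglongrightarrow> grid_visit_prob (M j) X e f h j"
    if "j \<in> S" for j
    using entry_prob_tendsto_grid_visit_prob[OF ct[OF that] fin h ef pos[OF that]] .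
  show "(\<lambda>N. entry_prob S (p h) e f (Suc N) i) \<longlonglongrightarrow> grid_visit_prob (M i) X e f h i"
    using lim[OF i] by (rule LIMSEQ_Suc)
  show "(\<lambda>N. entry_prob S (p h) e f (Suc N) i) \<longlonglongrightarrow>
    (\<Sum>j\<in>S. p h i j * (if j = i \<or> j \<notin> {e, f} then grid_visit_prob (M j) X e f h j
                       else of_bool (j = e)))"
    unfolding entry_prob.simps
    by (intro tendsto_sum tendsto_mult tendsto_const) (use lim in auto)
qed

section \<open>Refining the grid\<close>

text \<open>
  For every path the grid event and the limit event eventually agree. Hence the indicators converge
  pointwise, which yields the measurability of the limit event and, by dominated convergence, its
  probability.
\<close>

lemma grid_visit_prob_tendsto:
  fixes hs :: "nat \<Rightarrow> real"
  assumes ct: "ctmc S p M X" and ef: "e \<noteq> f" and hs: "filterlim hs (at_right 0) sequentially"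
    and hs_pos: "\<And>n. 0 < hs n"
  shows "(\<lambda>n. grid_visit_prob M X e f (hs n) i) \<longlonglongrightarrow>
    \<P>(w in M. return_or_hit_time X e w < return_or_hit_time X f w \<bar> X 0 w = i)"
proof -
  interpret prob_space M using ct by (simp add: ctmc_def)
  have [measurable]: "X 0 \<in> measurable M (count_space UNIV)"
    using ct by (intro ctmc_measurable) auto
  have [measurable]: "{w \<in> space M. enters_first e f (\<lambda>k. X (real k * hs n) w) N} \<in> sets M" for n N
    using enters_first_measurable[OF ct hs_pos[of n], of e f 0 N] by simp
  define D where "D n = {w \<in> space M. (\<exists>N. enters_first e f (\<lambda>k. X (real k * hs n) w) N) \<and> X 0 w = i}" for n
  define L where "L = {w \<in> space M. return_or_hit_time X e w < return_or_hit_time X f w \<and> X 0 w = i}"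
  have D[measurable]: "D n \<in> sets M" for n unfolding D_def by measurable
  have ev: "\<forall>\<^sub>F n in sequentially. w \<in> D n \<longleftrightarrow> w \<in> L" if w: "w \<in> space M" for w
  proof -
    have "right_constant (\<lambda>t. X t w)"
      using ct w by (intro right_constantI) (auto simp: ctmc_def)
    from eventually_compose_filterlim[OF grid_detects_first_entry[OF this ef] hs]
    show ?thesis
      by eventually_elim (use w in \<open>auto simp: D_def L_def return_or_hit_time_eq_Inf_entry\<close>)
  qed
  have lim: "(\<lambda>n. indicator (D n) w :: real) \<longlonglongrightarrow> indicator L w" if "w \<in> space M" for w
    using ev[OF that] by (intro tendsto_eventually) (auto elim!: eventually_mono simp: indicator_def)
  have L: "L \<in> sets M"
  proof -
    have "(indicator L :: _ \<Rightarrow> real) \<in> borel_measurable M"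
    proof (rule borel_measurable_LIMSEQ_real)
      show "(\<lambda>n. indicator (D n) w :: real) \<longlonglongrightarrow> indicator L w" if "w \<in> space M" for w
        using that by (rule lim)
    qed simp
    moreover have "L \<inter> space M = L" by (auto simp: L_def)
    ultimately show ?thesis
      by (simp add: borel_measurable_indicator_iff)
  qed
  have "(\<lambda>n. \<integral>w. indicator (D n) w \<partial>M) \<longlonglongrightarrow> (\<integral>w. indicator L w \<partial>M :: real)"
    using lim L by (intro integral_dominated_convergence[where w="\<lambda>_. 1"]) (auto simp: indicator_def)
  then have "(\<lambda>n. prob (D n)) \<longlonglongrightarrow> prob L"
    using L by simp
  then have "(\<lambda>n. prob (D n) / prob {w \<in> space M. X 0 w = i}) \<longlonglongrightarrow>
      prob L / prob {w \<in> space M. X 0 w = i}"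
    by (cases "prob {w \<in> space M. X 0 w = i} = 0") (auto intro!: tendsto_intros)
  then show ?thesis
    by (simp add: grid_visit_prob_def cond_prob_def D_def L_def)
qed

text \<open>
  The limit of the first-step equations after subtracting the left-hand side and dividing by the grid
  width.
\<close>

lemma first_visit_prob_equation:
  assumes fin: "finite S" and tf: "transition_function S p" and tr: "transition_rates S p Q"
    and ct: "\<And>i. i \<in> S \<Longrightarrow> ctmc S p (M i) X"
    and pos: "\<And>i. i \<in> S \<Longrightarrow> 0 < \<P>(w in M i. X 0 w = i)"
    and e: "e \<in> {1, 2}" "e \<in> S" and i: "i \<in> S"
  shows "(\<Sum>j\<in>S. Q0 Q i j * first_visit_prob M X j e) = (if i = e then 0 else - Q i e)"
proof -
  define f where "f = 3 - e"
  have ef: "e \<noteq> f" "{e, f} = {1, 2}" using e by (auto simp: f_def)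
  define hs where "hs n = 1 / real (Suc n)" for n
  have hs_pos: "0 < hs n" for n by (simp add: hs_def)
  have hs: "filterlim hs (at_right 0) sequentially"
    unfolding hs_def by real_asymp
  define u where "u n j = grid_visit_prob (M j) X e f (hs n) j" for n j
  define c where "c v j = (if j = i \<or> j \<notin> {e, f} then v j else of_bool (j = e))"
    for v :: "nat \<Rightarrow> real" and j
  let ?v = "\<lambda>j. first_visit_prob M X j e"
  have u_lim: "(\<lambda>n. u n j) \<longlonglongrightarrow> ?v j" if "j \<in> S" for j
    using grid_visit_prob_tendsto[OF ct[OF that] ef(1) hs hs_pos]
    by (simp add: u_def first_visit_prob_def f_def)
  \<comment> \<open>Since \<open>c v i = v i\<close>, the first-step equation says that these sums vanish.\<close>
  have "(\<lambda>n. \<Sum>j\<in>S. (p (hs n) i j - of_bool (i = j)) / hs n * c (u n) j) \<longlonglongrightarrow>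
      (\<Sum>j\<in>S. Q i j * c ?v j)"
  proof (intro tendsto_sum tendsto_mult)
    fix j assume j: "j \<in> S"
    show "(\<lambda>n. (p (hs n) i j - of_bool (i = j)) / hs n) \<longlonglongrightarrow> Q i j"
      using filterlim_compose[OF transition_function_has_generator[OF tf tr fin i j] hs] .
    show "(\<lambda>n. c (u n) j) \<longlonglongrightarrow> c ?v j"
      using u_lim[OF j] by (simp add: c_def)
  qed
  moreover have "(\<Sum>j\<in>S. (p (hs n) i j - of_bool (i = j)) / hs n * c (u n) j) = 0" for n
  proof -
    have "u n i = (\<Sum>j\<in>S. p (hs n) i j * c (u n) j)"
      unfolding u_def c_def by (rule grid_visit_prob_first_step[OF fin hs_pos ef(1) i ct pos])
    moreover have "(\<Sum>j\<in>S. of_bool (i = j) * c (u n) j) = u n i"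
      using fin i by (simp add: c_def of_bool_def if_distrib[of "\<lambda>y. y * _"] sum.delta cong: if_cong)
    ultimately have "(\<Sum>j\<in>S. (p (hs n) i j - of_bool (i = j)) * c (u n) j) / hs n = 0"
      by (simp add: algebra_simps sum_subtractf)
    then show ?thesis by (simp add: sum_divide_distrib)
  qed
  ultimately have "(\<Sum>j\<in>S. Q i j * c ?v j) = 0"
    by (simp add: LIMSEQ_const_iff)
  moreover have "Q i j * c ?v j = Q0 Q i j * ?v j + (if j = e then (if i = e then 0 else Q i e) else 0)" for j
    using ef e by (auto simp: c_def Q0_def)
  ultimately show ?thesis
    using fin e by (simp add: sum.distrib split: if_splits)
qed

section \<open>The linear systems\<close>

lemma state_mat_mult_eq_state_vec_iff:
  assumes "v \<in> carrier_vec s"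
  shows "state_mat s A *\<^sub>v v = state_vec s b \<longleftrightarrow>
    (\<forall>i\<in>{1..s}. (\<Sum>j\<in>{1..s}. A i j * vec_index v (j - 1)) = b i)"
proof -
  have shift: "(\<Sum>j\<in>{1..s}. g j) = (\<Sum>j<s. g (Suc j))" for g :: "nat \<Rightarrow> real"
    by (rule sum.reindex_bij_witness[of _ Suc "\<lambda>j. j - 1"]) auto
  have all: "(\<forall>i\<in>{1..s}. R i) \<longleftrightarrow> (\<forall>i<s. R (Suc i))" for R
    by (metis Suc_le_eq Suc_pred atLeastAtMost_iff less_eq_Suc_le One_nat_def Suc_le_mono le0)
  show ?thesis
    unfolding all shift using assms
    by (auto simp: vec_eq_iff state_mat_def state_vec_def scalar_prod_def atLeast0LessThan)
qed

lemma state_vec_index: "j \<in> {1..s} \<Longrightarrow> vec_index (state_vec s v) (j - 1) = v j"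
  by (auto simp: state_vec_def)

lemma unique_solution_state_vec:
  assumes ker: "\<And>u. (\<And>i. i \<in> {1..s} \<Longrightarrow> (\<Sum>j\<in>{1..s}. A i j * u j) = 0) \<Longrightarrow>
      (\<And>i. i \<in> {1..s} \<Longrightarrow> u i = 0)"
    and sol: "\<And>i. i \<in> {1..s} \<Longrightarrow> (\<Sum>j\<in>{1..s}. A i j * v j) = b i"
  shows "{v \<in> carrier_vec s. state_mat s A *\<^sub>v v = state_vec s b} = {state_vec s v}"
proof (intro equalityI subsetI)
  fix y assume "y \<in> {v \<in> carrier_vec s. state_mat s A *\<^sub>v v = state_vec s b}"
  then have y: "y \<in> carrier_vec s"
    and eq: "\<And>i. i \<in> {1..s} \<Longrightarrow> (\<Sum>j\<in>{1..s}. A i j * vec_index y (j - 1)) = b i"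
    using state_mat_mult_eq_state_vec_iff[of y s A b] by auto
  have "vec_index y (i - 1) - v i = 0" if "i \<in> {1..s}" for i
    using ker[of "\<lambda>j. vec_index y (j - 1) - v j" i] that eq sol
    by (simp add: right_diff_distrib sum_subtractf)
  then have "vec_index y i = v (Suc i)" if "i < s" for i
    using that by force
  with y have "y = state_vec s v"
    by (intro eq_vecI) (auto simp: state_vec_def)
  then show "y \<in> {state_vec s v}" by simp
next
  fix y assume y: "y \<in> {state_vec s v}"
  then have "y \<in> carrier_vec s" by (simp add: state_vec_def)
  moreover have "(\<Sum>j\<in>{1..s}. A i j * vec_index y (j - 1)) = b i" if "i \<in> {1..s}" for i
  proof -
    have "(\<Sum>j\<in>{1..s}. A i j * vec_index y (j - 1)) = (\<Sum>j\<in>{1..s}. A i j * v j)"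
      using y by (intro sum.cong refl) (simp only: singleton_iff state_vec_index)
    with sol[OF that] show ?thesis by simp
  qed
  ultimately show "y \<in> {v \<in> carrier_vec s. state_mat s A *\<^sub>v v = state_vec s b}"
    using state_mat_mult_eq_state_vec_iff[of y s A b] by auto
qed

theorem proposition3:
  fixes s :: nat
    and Q :: "nat \<Rightarrow> nat \<Rightarrow> real"
    and p :: "real \<Rightarrow> nat \<Rightarrow> nat \<Rightarrow> real"
    and M :: "nat \<Rightarrow> 'w measure"
    and X :: "real \<Rightarrow> 'w \<Rightarrow> nat"
  assumes "2 \<le> s"
    and "transition_function {1..s} p"
    and "transition_rates {1..s} p Q"
    and "irreducible_chain {1..s} p"
    and "\<And>i. i \<in> {1..s} \<Longrightarrow> ctmc {1..s} p (M i) X"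
    and "\<And>i. i \<in> {1..s} \<Longrightarrow> \<P>(w in M i. X 0 w = i) > 0"
  shows "{v \<in> carrier_vec s. state_mat s (Q0 Q) *\<^sub>v v =
            state_vec s (\<lambda>i. if i = 1 then 0 else - Q i 1)} =
           {state_vec s (\<lambda>i. first_visit_prob M X i 1)} \<and>
         {v \<in> carrier_vec s. state_mat s (Q0 Q) *\<^sub>v v =
            state_vec s (\<lambda>i. if i = 2 then 0 else - Q i 2)} =
           {state_vec s (\<lambda>i. first_visit_prob M X i 2)} \<and>
         (\<forall>e\<in>{1, 2}. first_visit_prob M X e 1 + first_visit_prob M X e 2 = 1)"
proof -
  let ?S = "{1..s}" and ?v = "\<lambda>e i. first_visit_prob M X i e"
  have S12: "1 \<in> ?S" "2 \<in> ?S" using assms(1) by auto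
  have ker: "u i = 0"
    if "\<And>i. i \<in> ?S \<Longrightarrow> (\<Sum>j\<in>?S. Q0 Q i j * u j) = 0" "i \<in> ?S" for u i
    using Q0_kernel_trivial[OF assms(2,3) _ assms(4) S12 that] by simp
  have sol: "(\<Sum>j\<in>?S. Q0 Q i j * ?v e j) = (if i = e then 0 else - Q i e)"
    if "e \<in> {1, 2}" "i \<in> ?S" for e i
  proof (rule first_visit_prob_equation[OF _ assms(2,3,5,6) that(1) _ that(2)])
    show "finite ?S" by simp
    show "e \<in> ?S" using that(1) S12 by auto
  qed
  have sum_one: "?v 1 i + ?v 2 i - 1 = 0" if "i \<in> ?S" for i
  proof (rule ker[of "\<lambda>i. ?v 1 i + ?v 2 i - 1", OF _ that])
    fix i assume i: "i \<in> ?S"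
    have "(\<Sum>j\<in>?S. Q i j) = 0"
      using assms(3) i sum.remove[of ?S i "Q i"] by (simp add: transition_rates_def)
    moreover define a b where "a = (if i = 1 then 0 else Q i 1)" and "b = (if i = 2 then 0 else Q i 2)"
    moreover have "Q0 Q i j = Q i j - (if j = 1 then a else 0) - (if j = 2 then b else 0)" for j
      by (auto simp: Q0_def a_def b_def)
    ultimately have "(\<Sum>j\<in>?S. Q0 Q i j) =
        (if i = 1 then 0 else - Q i 1) + (if i = 2 then 0 else - Q i 2)"
      using S12 by (simp add: sum_subtractf)
    with sol[of 1 i] sol[of 2 i] i
    show "(\<Sum>j\<in>?S. Q0 Q i j * (?v 1 j + ?v 2 j - 1)) = 0"
      by (simp add: algebra_simps sum.distrib sum_subtractf)
  qed
  have "?v 1 e + ?v 2 e = 1" if "e \<in> {1, 2}" for e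
  proof -
    have "e \<in> ?S" using that S12 by auto
    from sum_one[OF this] show ?thesis by simp
  qed
  moreover have "{v \<in> carrier_vec s. state_mat s (Q0 Q) *\<^sub>v v =
      state_vec s (\<lambda>i. if i = e then 0 else - Q i e)} = {state_vec s (?v e)}" if "e \<in> {1, 2}" for e
  proof (rule unique_solution_state_vec)
    show "u i = 0" if "\<And>i. i \<in> ?S \<Longrightarrow> (\<Sum>j\<in>?S. Q0 Q i j * u j) = 0" "i \<in> ?S" for u i
      using that by (rule ker)
    show "(\<Sum>j\<in>?S. Q0 Q i j * ?v e j) = (if i = e then 0 else - Q i e)" if "i \<in> ?S" for i
      by (rule sol[OF \<open>e \<in> {1, 2}\<close> that])
  qed
  ultimately show ?thesis by blast
qed

end
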